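(* Let $g(x,y)$ and $h(x,y)$ be alternating invariant functions. Define $$g\ast h(x,y)=\int_0^x g(t,y)\,h(x-t,y)\,dt-\int_x^y g(t,y)\,h(x+y-t,y)\,dt .$$ Then $g\ast h$ is an alternating invariant function.
   Context: A real function $f(x,y)$ defined for $x\in\mathbb{R}$, $y>0$ is called an alternating invariant function if $\sum_{r=0}^{n-1}(-1)^r f(x+ry,ny)=f(x,y)$ for every $x\in\mathbb{R}$, $y>0$ and every positive odd integer $n$. *)

theory Defs
  imports "HOL-Analysis.Analysis"
begin

(* A function f(x,y) on x real, y > 0 is represented by a total curried function;
   its values at y <= 0 are irrelevant. *)
definition alternating_invariant :: "(real \<Rightarrow> real \<Rightarrow> real) \<Rightarrow> bool" where
  "alternating_invariant f \<longleftrightarrow>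
     (\<forall>x y. \<forall>n::nat. y > 0 \<longrightarrow> odd n \<longrightarrow>
        (\<Sum>r<n. (-1) ^ r * f (x + real r * y) (real n * y)) = f x y)"

(* The integral from a to b with the usual sign convention for a > b.  The underlying
   Henstock-Kurzweil integral extends both the Riemann and the Lebesgue integral. *)
definition oriented_integral :: "real \<Rightarrow> real \<Rightarrow> (real \<Rightarrow> real) \<Rightarrow> real" where
  "oriented_integral a b f = (if a \<le> b then integral {a..b} f else - integral {b..a} f)"

definition alt_conv ::
    "(real \<Rightarrow> real \<Rightarrow> real) \<Rightarrow> (real \<Rightarrow> real \<Rightarrow> real) \<Rightarrow> real \<Rightarrow> real \<Rightarrow> real" where
  "alt_conv g h x y =
     oriented_integral 0 x (\<lambda>t. g t y * h (x - t) y)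
     - oriented_integral x y (\<lambda>t. g t y * h (x + y - t) y)"

(* Both integrals defining alt_conv g h x y exist for every real x and y > 0;
   closed_segment a b is the interval between a and b, in either order. *)
definition alt_conv_exists ::
    "(real \<Rightarrow> real \<Rightarrow> real) \<Rightarrow> (real \<Rightarrow> real \<Rightarrow> real) \<Rightarrow> bool" where
  "alt_conv_exists g h \<longleftrightarrow>
     (\<forall>x y. y > 0 \<longrightarrow>
        (\<lambda>t. g t y * h (x - t) y) integrable_on closed_segment 0 x \<and>
        (\<lambda>t. g t y * h (x + y - t) y) integrable_on closed_segment x y)"

end

theory Submission imports Defs begin

text \<open>Put \<open>Y = n y\<close> and expand both factors at level \<open>y\<close> by invariance. After translating the
  variable, every term is an integral of \<open>G c s = g s Y * h (c - s) Y\<close> with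
  \<open>c = x + (a + b) y\<close> or \<open>c = x + (a + b + 1) y\<close>. In terms of the primitives of \<open>G c\<close>, the double
  sum over \<open>a\<close> and \<open>b\<close> telescopes, the terms evaluated at multiples of \<open>y\<close> along \<open>a\<close> and the
  others along \<open>b\<close>, leaving precisely the alternating sum at level \<open>Y\<close>.\<close>

text \<open>Additivity over adjacent intervals, applied in each order of the three points;
  integrability on one interval containing them all passes to every subinterval.\<close>

lemma oriented_integral_diff:
  assumes f: "f integrable_on {l..m}" and m: "w \<in> {l..m}" "u \<in> {l..m}" "v \<in> {l..m}"
  shows "oriented_integral u v f = oriented_integral w v f - oriented_integral w u f"
proof -
  have sub: "f integrable_on {a..b}" if "l \<le> a" "b \<le> m" for a b
    using integrable_on_subinterval[OF f] that by auto
  have C: "integral {a..c} f + integral {c..b} f = integral {a..b} f"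
    if "l \<le> a" "a \<le> c" "c \<le> b" "b \<le> m" for a b c
    using Henstock_Kurzweil_Integration.integral_combine[OF that(2,3) sub] that by auto
  show ?thesis
    using m C[of u v w] C[of u w v] C[of v u w] C[of v w u] C[of w u v] C[of w v u]
    by (auto simp: oriented_integral_def)
qed

lemma oriented_integral_shift:
  "oriented_integral p q (\<lambda>t. f (t + d)) = oriented_integral (p + d) (q + d) f"
  using integral_shift_Icc_real[of p q f d] integral_shift_Icc_real[of q p f d]
  by (simp add: oriented_integral_def o_def add.commute)

lemma oriented_integral_sum:
  assumes "finite S" "\<And>i. i \<in> S \<Longrightarrow> f i integrable_on closed_segment p q"
  shows "oriented_integral p q (\<lambda>t. \<Sum>i\<in>S. f i t) = (\<Sum>i\<in>S. oriented_integral p q (f i))"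
  using assms
  by (auto simp: oriented_integral_def closed_segment_eq_real_ivl Henstock_Kurzweil_Integration.integral_sum
      sum_negf)

lemma oriented_integral_mult_left:
  fixes c :: real
  shows "oriented_integral p q (\<lambda>t. c * f t) = c * oriented_integral p q f"
  by (simp add: oriented_integral_def)

text \<open>The interval is \<open>{c - y..y}\<close> if \<open>c \<le> y\<close> and \<open>{0..c}\<close> otherwise. Every endpoint met in the
  expansion lies in it, so the separate terms are integrable as well.\<close>
lemma alt_conv_exists_integrable:
  assumes "alt_conv_exists g h" "y > 0"
  shows "(\<lambda>s. g s y * h (c - s) y) integrable_on {min 0 (c - y)..max c y}"
proof (cases "c \<le> y")
  case True
  have "(\<lambda>s. g s y * h (c - y + y - s) y) integrable_on closed_segment (c - y) y"
    using assms unfolding alt_conv_exists_def by blast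
  then show ?thesis using True assms(2) by (simp add: closed_segment_eq_real_ivl split: if_splits)
next
  case False
  have "(\<lambda>s. g s y * h (c - s) y) integrable_on closed_segment 0 c"
    using assms unfolding alt_conv_exists_def by blast
  then show ?thesis using False assms(2) by (simp add: closed_segment_eq_real_ivl)
qed

theorem theorem1p4:
  fixes g h :: "real \<Rightarrow> real \<Rightarrow> real"
  assumes "alternating_invariant g"
    and "alternating_invariant h"
    and "alt_conv_exists g h"
  shows "alternating_invariant (alt_conv g h)"
  unfolding alternating_invariant_def
proof (intro allI impI)
  fix x y :: real and n :: nat
  assume y: "y > 0" and n: "odd n"
  define Y where "Y = real n * y"
  define G where "G = (\<lambda>c s. g s Y * h (c - s) Y)"
  define R where "R = (\<lambda>c. {min 0 (c - Y)..max c Y})"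
  \<comment> \<open>\<open>J c\<close> is the primitive of \<open>G c\<close> based at
    \<open>0\<close>, a point of every \<open>R c\<close> because \<open>Y > 0\<close>.\<close>
  define J where "J = (\<lambda>c u. oriented_integral 0 u (G c))"
  have Y: "Y > 0"
    using y n by (auto simp: Y_def intro!: mult_pos_pos odd_pos)
  have G: "G c integrable_on R c" for c
    unfolding G_def R_def by (rule alt_conv_exists_integrable[OF assms(3) Y])
  have J: "oriented_integral u v (G c) = J c v - J c u" if "u \<in> R c" "v \<in> R c" for u v c
    unfolding J_def
    by (rule oriented_integral_diff[OF G[unfolded R_def]]) (use that Y in \<open>auto simp: R_def\<close>)
  have expand: "oriented_integral p q (\<lambda>t. g t y * h (z - t) y) =
      (\<Sum>a<n. \<Sum>b<n. (-1) ^ (a + b) *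
        (J (z + real (a + b) * y) (q + real a * y) - J (z + real (a + b) * y) (p + real a * y)))"
    if pq: "\<And>a b. a < n \<Longrightarrow> b < n \<Longrightarrow>
        p + real a * y \<in> R (z + real (a + b) * y) \<and> q + real a * y \<in> R (z + real (a + b) * y)"
    for p q z
  proof -
    \<comment> \<open>Since \<open>z - t + b y = (z + (a + b) y) - (t + a y)\<close>, the product of
      the \<open>a\<close>-th term for \<open>g\<close> and the \<open>b\<close>-th term for
      \<open>h\<close> is \<open>G (z + (a + b) y)\<close> translated by \<open>a y\<close>.\<close>
    define T where "T = (\<lambda>a b t. G (z + real (a + b) * y) (t + real a * y))"
    have T: "T a b integrable_on closed_segment p q" if "a < n" "b < n" for a b
    proof -
      have "G (z + real (a + b) * y) integrable_on {min p q + real a * y..max p q + real a * y}"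
        by (rule integrable_on_subinterval[OF G])
          (use pq[OF that] in \<open>auto simp: R_def\<close>)
      then show ?thesis
        using integrable_on_shift_Icc_real[of "G (z + real (a + b) * y)" "real a * y" "min p q" "max p q"]
        by (auto simp: T_def o_def add.commute closed_segment_eq_real_ivl min_def max_def
            split: if_splits)
    qed
    have "g t y * h (z - t) y = (\<Sum>a<n. \<Sum>b<n. (-1) ^ (a + b) * T a b t)" for t
    proof -
      have "g t y = (\<Sum>a<n. (-1) ^ a * g (t + real a * y) Y)"
        using assms(1) y n by (simp add: alternating_invariant_def Y_def)
      moreover have "h (z - t) y = (\<Sum>b<n. (-1) ^ b * h (z - t + real b * y) Y)"
        using assms(2) y n by (simp add: alternating_invariant_def Y_def)
      ultimately show ?thesis
        by (simp add: sum_product T_def G_def power_add algebra_simps)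
    qed
    then have "oriented_integral p q (\<lambda>t. g t y * h (z - t) y)
        = oriented_integral p q (\<lambda>t. \<Sum>a<n. \<Sum>b<n. (-1) ^ (a + b) * T a b t)"
      by simp
    also have "\<dots> = (\<Sum>a<n. oriented_integral p q (\<lambda>t. \<Sum>b<n. (-1) ^ (a + b) * T a b t))"
      by (intro oriented_integral_sum integrable_sum integrable_on_mult_right T) auto
    also have "\<dots> = (\<Sum>a<n. \<Sum>b<n. oriented_integral p q (\<lambda>t. (-1) ^ (a + b) * T a b t))"
      by (intro sum.cong refl oriented_integral_sum integrable_on_mult_right T) auto
    also have "\<dots> = (\<Sum>a<n. \<Sum>b<n. (-1) ^ (a + b) * oriented_integral p q (T a b))"
      by (simp add: oriented_integral_mult_left)
    also have "\<dots> = (\<Sum>a<n. \<Sum>b<n. (-1) ^ (a + b) *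
        (J (z + real (a + b) * y) (q + real a * y) - J (z + real (a + b) * y) (p + real a * y)))"
      using pq by (intro sum.cong refl) (simp add: T_def oriented_integral_shift J)
    finally show ?thesis .
  qed
  \<comment> \<open>The spare \<open>y\<close> keeps the endpoint \<open>y + a y\<close> of the
    second integral below \<open>Y\<close>.\<close>
  have le: "0 \<le> real a * y \<and> real a * y + y \<le> Y" if "a < n" for a
  proof -
    have "real (Suc a) * y \<le> real n * y"
      using that y by (intro mult_right_mono) auto
    then show ?thesis using y by (simp add: Y_def algebra_simps)
  qed
  \<comment> \<open>\<open>A\<close> collects the values at multiples of \<open>y\<close>,
    \<open>B\<close> those at points \<open>x + a y\<close>; \<open>k\<close> fixes both the sign
    and the parameter \<open>x + k y\<close>.\<close>
  define A where "A = (\<lambda>a k. (-1) ^ k * J (x + real k * y) (real a * y))"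
  define B where "B = (\<lambda>a k. (-1) ^ k * J (x + real k * y) (x + real a * y))"
  have 1: "oriented_integral 0 x (\<lambda>t. g t y * h (x - t) y) =
      (\<Sum>a<n. \<Sum>b<n. B a (a + b) - A a (a + b))"
  proof (subst expand)
    fix a b assume "a < n" "b < n"
    with le[of a] le[of b] y show "0 + real a * y \<in> R (x + real (a + b) * y) \<and>
        x + real a * y \<in> R (x + real (a + b) * y)"
      unfolding R_def of_nat_add distrib_right atLeastAtMost_iff by linarith
  qed (simp add: A_def B_def algebra_simps)
  \<comment> \<open>Here \<open>z = x + y\<close> raises \<open>k\<close> to
    \<open>Suc (a + b)\<close>. The extra sign reverses the difference, and the endpoint
    \<open>y + a y\<close> gives \<open>Suc a\<close> in \<open>A\<close>.\<close>
  have 2: "oriented_integral x y (\<lambda>t. g t y * h (x + y - t) y) =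
      (\<Sum>a<n. \<Sum>b<n. B a (Suc (a + b)) - A (Suc a) (Suc (a + b)))"
  proof (subst expand)
    fix a b assume "a < n" "b < n"
    with le[of a] le[of b] y show "x + real a * y \<in> R (x + y + real (a + b) * y) \<and>
        y + real a * y \<in> R (x + y + real (a + b) * y)"
      unfolding R_def of_nat_add distrib_right atLeastAtMost_iff by linarith
  qed (simp add: A_def B_def algebra_simps)
  \<comment> \<open>Both indices of \<open>A\<close> grow with \<open>a\<close>, so the sum over
    \<open>a\<close> collapses for fixed \<open>b\<close>; for \<open>B\<close> the inner sum over
    \<open>b\<close> collapses directly.\<close>
  have telA: "(\<Sum>a<n. \<Sum>b<n. A (Suc a) (Suc (a + b)) - A a (a + b)) = (\<Sum>b<n. A n (n + b) - A 0 b)"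
    using sum_lessThan_telescope[of "\<lambda>a. A a (a + b)" n for b]
    by (subst sum.swap) simp
  have telB: "(\<Sum>b<n. B a (Suc (a + b)) - B a (a + b)) = B a (a + n) - B a a" for a
    using sum_lessThan_telescope[of "\<lambda>b. B a (a + b)" n] by simp
  have "alt_conv g h x y = (\<Sum>a<n. \<Sum>b<n. A (Suc a) (Suc (a + b)) - A a (a + b))
      - (\<Sum>a<n. \<Sum>b<n. B a (Suc (a + b)) - B a (a + b))"
    unfolding alt_conv_def 1 2 by (simp add: sum_subtractf)
  also have "\<dots> = (\<Sum>r<n. (B r r - A 0 r) - (B r (r + n) - A n (r + n)))"
    unfolding telA telB by (simp add: sum_subtractf add.commute)
  also have "\<dots> = (\<Sum>r<n. (-1) ^ r * alt_conv g h (x + real r * y) Y)"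
  proof (intro sum.cong refl)
    fix r assume "r \<in> {..<n}"
    then have r: "0 \<le> real r * y" "real r * y \<le> Y" using le[of r] y by auto
    define z where "z = x + real r * y"
    have "alt_conv g h z Y = oriented_integral 0 z (G z) - oriented_integral z Y (G (z + Y))"
      by (simp add: alt_conv_def G_def)
    also have "\<dots> = (J z z - J z 0) - (J (z + Y) Y - J (z + Y) z)"
      using r Y by (subst (1 2) J) (auto simp: R_def z_def)
    finally have conv: "alt_conv g h z Y = \<dots>" .
    have "x + real (r + n) * y = z + Y"
      by (simp add: z_def Y_def algebra_simps)
    then have "B r r - A 0 r = (-1) ^ r * (J z z - J z 0)"
      "B r (r + n) - A n (r + n) = (-1) ^ r * (J (z + Y) Y - J (z + Y) z)"
      \<comment> \<open>As \<open>n\<close> is odd, \<open>(-1) ^ (r + n) = - (-1) ^ r\<close>,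
        which turns \<open>B - A\<close> into the integral from \<open>z\<close> to \<open>Y\<close>
        with sign \<open>(-1) ^ r\<close>.\<close>
      using n unfolding A_def B_def
      by (simp_all add: power_add z_def[symmetric] Y_def[symmetric] right_diff_distrib)
    then show "(B r r - A 0 r) - (B r (r + n) - A n (r + n)) =
        (-1) ^ r * alt_conv g h (x + real r * y) Y"
      by (simp add: conv z_def[symmetric] right_diff_distrib)
  qed
  finally show "(\<Sum>r<n. (-1) ^ r * alt_conv g h (x + real r * y) (real n * y)) = alt_conv g h x y"
    by (simp add: Y_def)
qed

end
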